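(* Let $G$ be a finite graph and $n$ a positive integer. Let $Z_G(\alpha,n)=\sum_{S}(\alpha-1)^{e(S)}n^{c(S)}$ (sum over all spanning subgraphs $S$ of $G$). Then $$Z_{G}(\alpha, n) = \sum_{i=0}^{\infty} \alpha^{i}\, C^{i}_{G}(n),$$ where $C^{i}_{G}(n)$ is the number of colorings of the nodes of $G$ with $n$ colors such that the endpoints of exactly $i$ edges receive the same color. In particular, $C^0_G(n)=C_G(n)$ is the number of proper colorings of the nodes of $G$ with $n$ colors.
   Context: $G$ is a finite graph (multiple edges and loops allowed). A spanning subgraph $S$ consists of all nodes of $G$ and a subset of its edges; $e(S)$ is its number of edges and $c(S)$ its number of connected components. $Z_G(\alpha,n)$ is the dichromatic polynomial in the variable $\alpha$; it satisfies $Z_{G}(\alpha,n)=Z_{G-e}(\alpha,n)+(\alpha-1)Z_{G/e}(\alpha,n)$ for an edge $e$ (where $G-e$ is deletion and $G/e$ is contraction of $e$) and $Z_{G\sqcup\bullet}(\alpha,n)=nZ_G(\alpha,n)$ for adding an isolated node $\bullet$. A coloring of the nodes is an arbitrary assignment of one of $n$ colors to each node; an edge is improper for a coloring if its two ends receive the same color (a loop is always improper); a coloring is proper if it has no improper edges. $\alpha$ is an indeterminate. *)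

theory Defs
  imports
    "HOL-Library.Uprod"
    "HOL-Library.FuncSet"
    "HOL-Library.Groups_Big_Fun"
    "HOL-Computational_Algebra.Polynomial"
begin

text \<open>
  Undirected graphs with multiple edges and loops: every edge name is mapped to the unordered pair
  of its ends, a loop at \<open>v\<close> having ends \<open>Upair v v\<close>. The values of \<open>ends\<close> outside \<open>edges\<close> are
  irrelevant.
\<close>

record ('v, 'e) mgraph =
  nodes :: "'v set"
  edges :: "'e set"
  ends :: "'e \<Rightarrow> 'v uprod"

definition finite_graph :: "('v, 'e) mgraph \<Rightarrow> bool" where
  "finite_graph G \<longleftrightarrow> finite (nodes G) \<and> finite (edges G) \<and>
     (\<forall>e\<in>edges G. set_uprod (ends G e) \<subseteq> nodes G)"

definition spanning_subgraphs :: "('v, 'e) mgraph \<Rightarrow> ('v, 'e) mgraph set" where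
  "spanning_subgraphs G = {S. nodes S = nodes G \<and> edges S \<subseteq> edges G \<and> ends S = ends G}"

definition adjacency :: "('v, 'e) mgraph \<Rightarrow> 'v rel" where
  "adjacency G = {(u, v). \<exists>e\<in>edges G. ends G e = Upair u v}"

definition connected_rel :: "('v, 'e) mgraph \<Rightarrow> 'v rel" where
  "connected_rel G = {(u, v). u \<in> nodes G \<and> v \<in> nodes G \<and> (u, v) \<in> (adjacency G)\<^sup>*}"

lemma equiv_connected_rel: "equiv (nodes G) (connected_rel G)"
proof (rule equivI)
  have "sym (adjacency G)"
    by (simp add: sym_def adjacency_def) (metis Upair_inject)
  then have "sym ((adjacency G)\<^sup>*)"
    by (rule sym_rtrancl)
  then show "sym (connected_rel G)"
    by (auto simp: sym_def connected_rel_def)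
qed (auto simp: refl_on_def trans_def connected_rel_def)

text \<open>Connected components are represented by their node sets.\<close>

definition components :: "('v, 'e) mgraph \<Rightarrow> 'v set set" where
  "components G = nodes G // connected_rel G"

definition num_edges :: "('v, 'e) mgraph \<Rightarrow> nat" where
  "num_edges G = card (edges G)"

definition num_components :: "('v, 'e) mgraph \<Rightarrow> nat" where
  "num_components G = card (components G)"

text \<open>The indeterminate \<open>\<alpha>\<close> of \<open>\<int>[\<alpha>]\<close>.\<close>

abbreviation indet :: "int poly" where
  "indet \<equiv> [:0, 1:]"

definition dichromatic_poly :: "('v, 'e) mgraph \<Rightarrow> nat \<Rightarrow> int poly" where
  "dichromatic_poly G n =
     (\<Sum>S\<in>spanning_subgraphs G. (indet - 1) ^ num_edges S * of_nat n ^ num_components S)"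

text \<open>Extensional functions, so that each coloring is counted once.\<close>

definition colorings :: "('v, 'e) mgraph \<Rightarrow> nat \<Rightarrow> ('v \<Rightarrow> nat) set" where
  "colorings G n = nodes G \<rightarrow>\<^sub>E {..<n}"

definition improper_edges :: "('v, 'e) mgraph \<Rightarrow> ('v \<Rightarrow> nat) \<Rightarrow> 'e set" where
  "improper_edges G f = {e \<in> edges G. \<exists>u v. ends G e = Upair u v \<and> f u = f v}"

definition proper :: "('v, 'e) mgraph \<Rightarrow> ('v \<Rightarrow> nat) \<Rightarrow> bool" where
  "proper G f \<longleftrightarrow> improper_edges G f = {}"

definition num_colorings_improper :: "('v, 'e) mgraph \<Rightarrow> nat \<Rightarrow> nat \<Rightarrow> nat" where
  "num_colorings_improper G i n = card {f \<in> colorings G n. card (improper_edges G f) = i}"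

definition num_proper_colorings :: "('v, 'e) mgraph \<Rightarrow> nat \<Rightarrow> nat" where
  "num_proper_colorings G n = card {f \<in> colorings G n. proper G f}"

end

theory Submission imports Defs begin

text \<open>
  Fix a spanning subgraph \<open>S\<close>. A coloring makes every edge of \<open>S\<close> improper exactly when it is
  constant on the components of \<open>S\<close>, so there are \<open>n ^ c(S)\<close> such colorings
  (\<open>card_colorings_all_edges_improper\<close>). Hence \<open>Z\<^sub>G\<close> is the sum of \<open>(\<alpha> - 1) ^ e(S)\<close> over all pairs
  of a coloring \<open>f\<close> and a set of edges that are improper for \<open>f\<close>. Summing over the subsets of the
  set of improper edges of \<open>f\<close> first gives \<open>((\<alpha> - 1) + 1) ^ k = \<alpha> ^ k\<close>, where \<open>k\<close> is the number of
  improper edges (\<open>sum_Pow_power_card\<close>), and it remains to group the colorings by \<open>k\<close>.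
\<close>

lemma sum_Pow_power_card:
  fixes x :: "'b::comm_semiring_1"
  assumes "finite X"
  shows "(\<Sum>A\<in>Pow X. x ^ card A) = (x + 1) ^ card X"
  using assms
proof (induction X rule: finite_induct)
  case empty
  then show ?case by simp
next
  case (insert a X)
  have inj: "inj_on (insert a) (Pow X)"
    using insert.hyps by (auto simp: inj_on_def)
  have "(\<Sum>A\<in>Pow (insert a X). x ^ card A)
      = (\<Sum>A\<in>Pow X. x ^ card A) + (\<Sum>A\<in>insert a ` Pow X. x ^ card A)"
    unfolding Pow_insert using insert.hyps by (intro sum.union_disjoint) auto
  also have "(\<Sum>A\<in>insert a ` Pow X. x ^ card A) = (\<Sum>A\<in>Pow X. x * x ^ card A)"
    unfolding sum.reindex[OF inj] o_def
  proof (rule sum.cong)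
    fix A assume "A \<in> Pow X"
    then have "finite A" "a \<notin> A"
      using insert.hyps finite_subset by auto
    then show "x ^ card (insert a A) = x * x ^ card A"
      by simp
  qed simp
  finally show ?case
    using insert by (simp add: sum_distrib_left[symmetric] algebra_simps)
qed

text \<open>Functions that are constant on the classes of \<open>r\<close> correspond to functions on the quotient.\<close>

lemma card_PiE_respecting_equiv:
  assumes "equiv A r" and "finite A"
  shows "card {f \<in> A \<rightarrow>\<^sub>E B. \<forall>(x, y)\<in>r. f x = f y} = card B ^ card (A // r)"
proof -
  let ?F = "{f \<in> A \<rightarrow>\<^sub>E B. \<forall>(x, y)\<in>r. f x = f y}"
  let ?lift = "\<lambda>h. restrict (\<lambda>x. h (r `` {x})) A"
  have fin: "finite (A // r)"
    using assms by (simp add: quotient_def)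
  have "bij_betw ?lift ((A // r) \<rightarrow>\<^sub>E B) ?F"
  proof (rule bij_betwI')
    fix g h assume gh: "g \<in> (A // r) \<rightarrow>\<^sub>E B" "h \<in> (A // r) \<rightarrow>\<^sub>E B"
    show "(?lift g = ?lift h) = (g = h)"
    proof
      assume eq: "?lift g = ?lift h"
      show "g = h"
      proof (rule PiE_ext[OF gh])
        fix C assume "C \<in> A // r"
        then obtain x where "x \<in> A" "C = r `` {x}"
          by (auto elim: quotientE)
        then show "g C = h C"
          using fun_cong[OF eq, of x] by simp
      qed
    qed simp
  next
    fix h assume "h \<in> (A // r) \<rightarrow>\<^sub>E B"
    moreover have "?lift h x = ?lift h y" if "(x, y) \<in> r" for x y
    proof -
      have "x \<in> A" "y \<in> A" "r `` {x} = r `` {y}"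
        using assms(1) that by (simp_all add: equiv_class_eq_iff)
      then show ?thesis
        by simp
    qed
    ultimately show "?lift h \<in> ?F"
      by (auto simp: PiE_iff quotientI)
  next
    fix f assume f: "f \<in> ?F"
    \<comment> \<open>As \<open>f\<close> is constant on each class, its values at chosen representatives determine it.\<close>
    let ?h = "restrict (\<lambda>C. f (SOME x. x \<in> C)) (A // r)"
    have rep: "(SOME x. x \<in> C) \<in> C" if "C \<in> A // r" for C
      using in_quotient_imp_non_empty[OF assms(1) that] by (simp add: some_in_eq)
    have "?h \<in> (A // r) \<rightarrow>\<^sub>E B"
      using f rep in_quotient_imp_subset[OF assms(1)] by (fastforce simp: PiE_iff)
    moreover have "f = ?lift ?h"
    proof (rule extensionalityI[of _ A])
      fix x assume x: "x \<in> A"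
      then have "(x, SOME y. y \<in> r `` {x}) \<in> r"
        using rep[OF quotientI[OF x]] by simp
      then show "f x = ?lift ?h x"
        using f x by (auto simp: quotientI)
    qed (use f in \<open>auto simp: PiE_iff\<close>)
    ultimately show "\<exists>h\<in>(A // r) \<rightarrow>\<^sub>E B. f = ?lift h"
      by blast
  qed
  then show ?thesis
    using fin by (simp add: bij_betw_same_card[symmetric] card_PiE)
qed

lemma all_edges_improper_iff:
  assumes "finite_graph G"
  shows "improper_edges G f = edges G \<longleftrightarrow> (\<forall>(u, v)\<in>connected_rel G. f u = f v)"
proof
  assume all: "improper_edges G f = edges G"
  have step: "f u = f v" if adj: "(u, v) \<in> adjacency G" for u v
  proof -
    obtain e where "e \<in> edges G" "ends G e = Upair u v"
      using adj by (auto simp: adjacency_def)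
    then have "e \<in> improper_edges G f"
      using all by simp
    with \<open>ends G e = Upair u v\<close> show ?thesis
      by (auto simp: improper_edges_def)
  qed
  have "f u = f v" if "(u, v) \<in> (adjacency G)\<^sup>*" for u v
    using that by (induction rule: rtrancl_induct) (auto dest: step)
  then show "\<forall>(u, v)\<in>connected_rel G. f u = f v"
    by (auto simp: connected_rel_def)
next
  assume const: "\<forall>(u, v)\<in>connected_rel G. f u = f v"
  have "e \<in> improper_edges G f" if e: "e \<in> edges G" for e
  proof -
    obtain u v where uv: "ends G e = Upair u v"
      by (cases "ends G e")
    then have "u \<in> nodes G" "v \<in> nodes G" "(u, v) \<in> adjacency G"
      using assms e by (force simp: finite_graph_def adjacency_def)+
    then have "(u, v) \<in> connected_rel G"
      by (auto simp: connected_rel_def)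
    with const have "f u = f v"
      by auto
    with e uv show ?thesis
      unfolding improper_edges_def by blast
  qed
  then show "improper_edges G f = edges G"
    by (auto simp: improper_edges_def)
qed

lemma card_colorings_all_edges_improper:
  assumes "finite_graph G"
  shows "card {f \<in> colorings G n. improper_edges G f = edges G} = n ^ num_components G"
  using card_PiE_respecting_equiv[OF equiv_connected_rel[of G], of "{..<n}"] assms
  by (simp add: all_edges_improper_iff colorings_def num_components_def components_def
      finite_graph_def)

lemma finite_colorings: "finite_graph G \<Longrightarrow> finite (colorings G n)"
  by (simp add: colorings_def finite_graph_def finite_PiE)

lemma finite_improper_edges: "finite_graph G \<Longrightarrow> finite (improper_edges G f)"
  by (simp add: improper_edges_def finite_graph_def)

lemma bij_betw_Pow_spanning_subgraphs:
  "bij_betw (\<lambda>A. G\<lparr>edges := A\<rparr>) (Pow (edges G)) (spanning_subgraphs G)"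
  by (rule bij_betw_byWitness[where f' = edges]) (auto simp: spanning_subgraphs_def)

lemma dichromatic_poly_eq_sum_colorings:
  assumes "finite_graph G"
  shows "dichromatic_poly G n = (\<Sum>f\<in>colorings G n. indet ^ card (improper_edges G f))"
proof -
  have fin: "finite (edges G)"
    using assms by (simp add: finite_graph_def)
  have count: "of_nat n ^ num_components (G\<lparr>edges := A\<rparr>)
      = (\<Sum>f\<in>colorings G n. if A \<subseteq> improper_edges G f then 1 else 0 :: int poly)"
    if "A \<subseteq> edges G" for A
  proof -
    have "finite_graph (G\<lparr>edges := A\<rparr>)"
      using assms that finite_subset by (auto simp: finite_graph_def)
    moreover have "improper_edges (G\<lparr>edges := A\<rparr>) f = A \<longleftrightarrow> A \<subseteq> improper_edges G f" for f
      using that by (auto simp: improper_edges_def)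
    moreover have "colorings (G\<lparr>edges := A\<rparr>) n = colorings G n"
      by (simp add: colorings_def)
    ultimately have "n ^ num_components (G\<lparr>edges := A\<rparr>)
        = card {f \<in> colorings G n. A \<subseteq> improper_edges G f}"
      using card_colorings_all_edges_improper[of "G\<lparr>edges := A\<rparr>" n] by simp
    then show ?thesis
      using finite_colorings[OF assms]
      by (simp flip: of_nat_power sum.inter_filter)
  qed
  have "dichromatic_poly G n = (\<Sum>A\<in>Pow (edges G).
      (indet - 1) ^ card A * of_nat n ^ num_components (G\<lparr>edges := A\<rparr>))"
    unfolding dichromatic_poly_def num_edges_def
    by (subst sum.reindex_bij_betw[OF bij_betw_Pow_spanning_subgraphs, symmetric]) simp
  also have "\<dots> = (\<Sum>A\<in>Pow (edges G). \<Sum>f\<in>colorings G n.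
      if A \<subseteq> improper_edges G f then (indet - 1) ^ card A else 0)"
    by (intro sum.cong) (simp_all add: count sum_distrib_left if_distrib cong: if_cong)
  also have "\<dots> = (\<Sum>f\<in>colorings G n. \<Sum>A\<in>Pow (edges G).
      if A \<subseteq> improper_edges G f then (indet - 1) ^ card A else 0)"
    by (rule sum.swap)
  also have "\<dots> = (\<Sum>f\<in>colorings G n. \<Sum>A\<in>Pow (improper_edges G f). (indet - 1) ^ card A)"
  proof (rule sum.cong)
    fix f
    have "Pow (improper_edges G f) = {A \<in> Pow (edges G). A \<subseteq> improper_edges G f}"
      by (auto simp: improper_edges_def)
    then show "(\<Sum>A\<in>Pow (edges G). if A \<subseteq> improper_edges G f then (indet - 1) ^ card A else 0)
        = (\<Sum>A\<in>Pow (improper_edges G f). (indet - 1) ^ card A)"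
      using fin by (simp only: sum.inter_filter finite_Pow_iff)
  qed simp
  also have "\<dots> = (\<Sum>f\<in>colorings G n. indet ^ card (improper_edges G f))"
    by (simp only: sum_Pow_power_card[OF finite_improper_edges[OF assms]] diff_add_cancel)
  finally show ?thesis .
qed

theorem mainTheorem2:
  fixes G :: "('v, 'e) mgraph" and n :: nat
  assumes "finite_graph G" and "n > 0"
  shows "finite {i. num_colorings_improper G i n \<noteq> 0} \<and>
    dichromatic_poly G n =
      Sum_any (\<lambda>i::nat. indet ^ i * of_nat (num_colorings_improper G i n)) \<and>
    num_colorings_improper G 0 n = num_proper_colorings G n"
proof (intro conjI)
  let ?k = "\<lambda>f. card (improper_edges G f)"
  let ?I = "?k ` colorings G n"
  have finI: "finite ?I"
    using finite_colorings[OF assms(1)] by simp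
  have supp: "i \<in> ?I" if "num_colorings_improper G i n \<noteq> 0" for i
  proof -
    have "{f \<in> colorings G n. ?k f = i} \<noteq> {}"
      using that unfolding num_colorings_improper_def by (metis card.empty)
    then show ?thesis
      by auto
  qed
  show "finite {i. num_colorings_improper G i n \<noteq> 0}"
    by (rule finite_subset[OF _ finI]) (use supp in auto)
  have "dichromatic_poly G n = (\<Sum>f\<in>colorings G n. indet ^ ?k f)"
    by (rule dichromatic_poly_eq_sum_colorings[OF assms(1)])
  also have "\<dots> = (\<Sum>i\<in>?I. \<Sum>f | f \<in> colorings G n \<and> ?k f = i. indet ^ ?k f)"
    by (rule sum.image_gen[OF finite_colorings[OF assms(1)]])
  also have "\<dots> = (\<Sum>i\<in>?I. indet ^ i * of_nat (num_colorings_improper G i n))"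
    by (intro sum.cong) (simp_all add: num_colorings_improper_def mult.commute)
  also have "\<dots> = Sum_any (\<lambda>i. indet ^ i * of_nat (num_colorings_improper G i n))"
    by (rule Sum_any.expand_superset[OF finI, symmetric]) (auto intro: supp)
  finally show "dichromatic_poly G n
      = Sum_any (\<lambda>i. indet ^ i * of_nat (num_colorings_improper G i n))" .
  show "num_colorings_improper G 0 n = num_proper_colorings G n"
    using finite_improper_edges[OF assms(1)]
    by (simp add: num_colorings_improper_def num_proper_colorings_def proper_def)
qed

end
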